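(* Let $\mathscr{M}$ be a von Neumann algebra acting on the Hilbert space $\mathcal{H}$. Let $\mathcal{V}$ be a linear subspace of $\mathcal{H}$. Then the following are equivalent: (i) $\mathcal{V}$ is the range of an operator in $\mathscr{M}$; (ii) $\mathcal{V}$ is the range of an operator in $\mathscr{M}_{\mathrm{aff}}^{\mathrm{MvN}}$; (iii) $\mathcal{V}$ is the domain of an operator in $\mathscr{M}_{\mathrm{aff}}^{\mathrm{MvN}}$; (iv) $\mathcal{V}$ is the domain of an operator in $\mathscr{M}_{\mathrm{aff}}$.
   Context: An unbounded operator on $\mathcal{H}$ is a linear map $T:\mathrm{dom}(T)\to\mathcal{H}$ with $\mathrm{dom}(T)$ a (not necessarily dense) linear subspace of $\mathcal{H}$, and $T$ not necessarily bounded. $T$ is closed if its graph is closed in $\mathcal{H}\oplus\mathcal{H}$. $\mathscr{M}_{\mathrm{aff}}^{\mathrm{MvN}}$ is the set of closed (not necessarily densely-defined) operators $T$ on $\mathcal{H}$ such that $U^*TU=T$ for every unitary $U$ in the commutant $\mathscr{M}'$. For $A,B\in\mathcal{B}(\mathcal{H})$ with $\mathrm{null}(B)\subseteq\mathrm{null}(A)$, the quotient $A/B$ is the unbounded operator with domain $\mathrm{ran}(B)$ given by $Bx\mapsto Ax$ ($x\in\mathcal{H}$), and $\mathscr{M}_{\mathrm{aff}} := \{A/B : A,B\in\mathscr{M},\ \mathrm{null}(B)\subseteq\mathrm{null}(A)\}$. *)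

theory Defs
  imports "HOL-Analysis.Analysis"
begin

text \<open>
  A complex Hilbert space is presented over the library's real Hilbert spaces (which provide norm,
  topology and completeness): the real inner product is the real part of the complex one, so the
  norm is the one induced by \<open>cinner\<close>, which is linear in its first argument.
\<close>

class complex_hilbert = real_inner + complete_space +
  fixes scaleC :: "complex \<Rightarrow> 'a \<Rightarrow> 'a"  (infixr \<open>*\<^sub>C\<close> 75)
    and cinner :: "'a \<Rightarrow> 'a \<Rightarrow> complex"
  assumes scaleC_add_right: "c *\<^sub>C (x + y) = c *\<^sub>C x + c *\<^sub>C y"
    and scaleC_add_left: "(c + d) *\<^sub>C x = c *\<^sub>C x + d *\<^sub>C x"
    and scaleC_scaleC: "c *\<^sub>C d *\<^sub>C x = (c * d) *\<^sub>C x"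
    and scaleC_one: "1 *\<^sub>C x = x"
    and scaleR_scaleC: "r *\<^sub>R x = complex_of_real r *\<^sub>C x"
    and cinner_commute: "cinner x y = cnj (cinner y x)"
    and cinner_add_left: "cinner (x + y) z = cinner x z + cinner y z"
    and cinner_scaleC_left: "cinner (c *\<^sub>C x) y = c * cinner x y"
    and inner_eq_Re_cinner: "inner x y = Re (cinner x y)"

global_interpretation cvec: vector_space "scaleC :: complex \<Rightarrow> 'a \<Rightarrow> 'a::complex_hilbert"
  by unfold_locales
    (simp_all add: scaleC_add_right scaleC_add_left scaleC_scaleC scaleC_one)

definition bounded_operators :: "('h::complex_hilbert \<Rightarrow> 'h) set" where
  "bounded_operators = {T. bounded_linear T \<and> Vector_Spaces.linear scaleC scaleC T}"

definition cadjoint :: "('h::complex_hilbert \<Rightarrow> 'h) \<Rightarrow> 'h \<Rightarrow> 'h" where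
  "cadjoint T = (THE S. \<forall>x y. cinner (T x) y = cinner x (S y))"

definition unitary :: "('h::complex_hilbert \<Rightarrow> 'h) \<Rightarrow> bool" where
  "unitary U \<longleftrightarrow> U \<in> bounded_operators \<and> cadjoint U \<circ> U = id \<and> U \<circ> cadjoint U = id"

definition commutant :: "('h::complex_hilbert \<Rightarrow> 'h) set \<Rightarrow> ('h \<Rightarrow> 'h) set" where
  "commutant M = {T \<in> bounded_operators. \<forall>S\<in>M. S \<circ> T = T \<circ> S}"

definition unital_star_subalgebra :: "('h::complex_hilbert \<Rightarrow> 'h) set \<Rightarrow> bool" where
  "unital_star_subalgebra M \<longleftrightarrow>
     M \<subseteq> bounded_operators \<and> id \<in> M \<and>
     (\<forall>S\<in>M. \<forall>T\<in>M. (\<lambda>x. S x + T x) \<in> M \<and> S \<circ> T \<in> M) \<and>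
     (\<forall>c. \<forall>T\<in>M. (\<lambda>x. c *\<^sub>C T x) \<in> M) \<and>
     (\<forall>T\<in>M. cadjoint T \<in> M)"

definition von_neumann_algebra :: "('h::complex_hilbert \<Rightarrow> 'h) set \<Rightarrow> bool" where
  "von_neumann_algebra M \<longleftrightarrow> unital_star_subalgebra M \<and> commutant (commutant M) = M"

text \<open>
  Unbounded operators are partial functions, so that equality of operators includes equality of
  domains; \<open>dom\<close>, \<open>ran\<close>, \<open>Map.graph\<close> and the composition \<open>\<circ>\<^sub>m\<close> (on its maximal domain) are
  the library's.
\<close>

definition unbounded_operator :: "('h::complex_hilbert \<rightharpoonup> 'h) \<Rightarrow> bool" where
  "unbounded_operator T \<longleftrightarrow>
     cvec.subspace (dom T) \<and>
     (\<forall>x\<in>dom T. \<forall>y\<in>dom T. the (T (x + y)) = the (T x) + the (T y)) \<and>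
     (\<forall>c. \<forall>x\<in>dom T. the (T (c *\<^sub>C x)) = c *\<^sub>C the (T x))"

definition closed_operator :: "('h::complex_hilbert \<rightharpoonup> 'h) \<Rightarrow> bool" where
  "closed_operator T \<longleftrightarrow> unbounded_operator T \<and> closed (Map.graph T)"

definition affiliated_MvN :: "('h::complex_hilbert \<Rightarrow> 'h) set \<Rightarrow> ('h \<rightharpoonup> 'h) set" where
  "affiliated_MvN M =
     {T. closed_operator T \<and>
         (\<forall>U \<in> commutant M. unitary U \<longrightarrow>
            (Some \<circ> cadjoint U) \<circ>\<^sub>m T \<circ>\<^sub>m (Some \<circ> U) = T)}"

definition null_space :: "('h::complex_hilbert \<Rightarrow> 'h) \<Rightarrow> 'h set" where
  "null_space T = {x. T x = 0}"

definition quotient_operator ::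
    "('h::complex_hilbert \<Rightarrow> 'h) \<Rightarrow> ('h \<Rightarrow> 'h) \<Rightarrow> ('h \<rightharpoonup> 'h)" where
  "quotient_operator A B =
     (\<lambda>y. if y \<in> range B then Some (THE z. \<exists>x. B x = y \<and> A x = z) else None)"

definition affiliated_quotients :: "('h::complex_hilbert \<Rightarrow> 'h) set \<Rightarrow> ('h \<rightharpoonup> 'h) set" where
  "affiliated_quotients M =
     {quotient_operator A B | A B. A \<in> M \<and> B \<in> M \<and> null_space B \<subseteq> null_space A}"

end

(*
  The graph G of a closed operator affiliated with M in the sense of Murray and von Neumann is a
  closed subspace of H + H invariant under U + U for all unitaries U in the commutant M'.
  Since M' is spanned by its unitaries, the corner E of the projection onto G lies in M'' = M.
  By the range argument of Douglas, the domain of the operator, i.e. the first projection of G, is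
  the range of the square root of E; exchanging the two summands treats the range of the operator.
  Conversely, the range of A in M is the range of the affiliated operator A itself and the domain of
  the affiliated operator inverting A on the orthogonal complement of its kernel.

  Orthogonality, adjoints and square roots only involve the real inner product: complex linearity
  of an operator is recovered from its commuting with multiplication by the imaginary unit.
*)

theory Submission
  imports Defs
begin

section \<open>Orthogonal projections and ranges of adjoints\<close>

text \<open>For small \<open>t\<close> the linear term dominates: with
  \<open>c > \<bar>b\<bar>\<close>, the choice \<open>t = - a / c\<close> makes the expression at
  most \<open>- (a\<^sup>2 / c)\<close>. This turns minimality into a vanishing first
  variation.\<close>

lemma linear_coeff_zero_of_quadratic_nonneg:
  fixes a b :: real
  assumes "\<And>t. 0 \<le> 2 * t * a + t\<^sup>2 * b"
  shows "a = 0"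
proof (rule ccontr)
  assume a: "a \<noteq> 0"
  define c where "c = \<bar>b\<bar> + 1"
  have c: "c > 0" "b < c" unfolding c_def by auto
  have "0 \<le> 2 * (- a / c) * a + (- a / c)\<^sup>2 * b" by (rule assms)
  also have "(- a / c)\<^sup>2 * b \<le> (- a / c)\<^sup>2 * c"
    by (rule mult_left_mono) (use c in auto)
  also have "2 * (- a / c) * a + (- a / c)\<^sup>2 * c = - (a\<^sup>2 / c)"
    using c by (simp add: field_simps power2_eq_square)
  finally show False using a c by (simp add: field_simps)
qed

text \<open>
  \<open>X\<close> need not be closed. The representing vector is the limit of any minimising sequence of
  \<open>\<parallel>x\<parallel>\<^sup>2 - 2 f x\<close> on \<open>X\<close>, which is Cauchy by the parallelogram law.
\<close>

lemma riesz_representation_subspace: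
  fixes X :: "'a::{real_inner,complete_space} set"
  assumes X: "subspace X"
    and add: "\<And>x y. x \<in> X \<Longrightarrow> y \<in> X \<Longrightarrow> f (x + y) = f x + f y"
    and scale: "\<And>r x. x \<in> X \<Longrightarrow> f (r *\<^sub>R x) = r * f x"
    and bound: "\<And>x. x \<in> X \<Longrightarrow> \<bar>f x\<bar> \<le> C * norm x"
  shows "\<exists>k\<in>closure X. \<forall>x\<in>X. f x = x \<bullet> k"
proof -
  define J where "J x = (norm x)\<^sup>2 - 2 * f x" for x
  define m where "m = Inf (J ` X)"
  have lower: "J x \<ge> - C\<^sup>2" if "x \<in> X" for x
  proof -
    have "0 \<le> (norm x - C)\<^sup>2" by simp
    with bound[OF that] show ?thesis
      by (simp add: J_def power2_diff algebra_simps abs_le_iff)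
  qed
  have bdd: "bdd_below (J ` X)"
    by (rule bdd_belowI2[of X "- C\<^sup>2"]) (rule lower)
  have m: "m \<le> J x" if "x \<in> X" for x
    unfolding m_def using that bdd by (intro cInf_lower) auto
  have "X \<noteq> {}" using subspace_0[OF X] by auto
  then have "\<exists>x\<in>X. J x < m + 1 / real (Suc n)" for n
    using cInf_lessD[of "J ` X" "m + 1 / real (Suc n)"] unfolding m_def by auto
  then obtain s where s: "s n \<in> X" "J (s n) < m + 1 / real (Suc n)" for n
    by metis
  \<comment> \<open>The midpoint \<open>?h\<close> stays in \<open>X\<close>, so \<open>J ?h\<close>
    is at least \<open>m\<close>, while \<open>J (s p)\<close> and \<open>J (s q)\<close> exceed
    \<open>m\<close> by less than the chosen tolerances.\<close>
  have parallelogram: "(norm (s p - s q))\<^sup>2 \<le> 2 / real (Suc p) + 2 / real (Suc q)" for p q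
  proof -
    let ?h = "(1/2) *\<^sub>R (s p + s q)"
    have h: "?h \<in> X" using X s(1) by (intro subspace_scale subspace_add)
    have "f ?h = (f (s p) + f (s q)) / 2"
      using s(1) subspace_add[OF X] by (subst scale) (auto simp: add)
    moreover have "(norm (s p - s q))\<^sup>2 = 2 * (norm (s p))\<^sup>2 + 2 * (norm (s q))\<^sup>2 - 4 * (norm ?h)\<^sup>2"
      by (simp add: power2_norm_eq_inner inner_simps inner_commute algebra_simps)
    ultimately have "(norm (s p - s q))\<^sup>2 = 2 * J (s p) + 2 * J (s q) - 4 * J ?h"
      by (simp add: J_def algebra_simps)
    with m[OF h] s(2)[of p] s(2)[of q] show ?thesis by linarith
  qed
  have "Cauchy s"
  proof (rule metric_CauchyI)
    fix e :: real assume e: "e > 0"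
    obtain N where N: "4 / e\<^sup>2 < real N" using reals_Archimedean2 by blast
    show "\<exists>M. \<forall>p\<ge>M. \<forall>q\<ge>M. dist (s p) (s q) < e"
    proof (intro exI allI impI)
      fix p q assume pq: "N \<le> p" "N \<le> q"
      have small: "2 / real (Suc r) < e\<^sup>2 / 2" if "N \<le> r" for r
      proof -
        have "4 / e\<^sup>2 < real (Suc r)" using N that by linarith
        then show ?thesis using e by (simp add: field_simps)
      qed
      have "(norm (s p - s q))\<^sup>2 < e\<^sup>2"
        using parallelogram[of p q] small[OF pq(1)] small[OF pq(2)] by linarith
      then show "dist (s p) (s q) < e"
        using e by (simp add: dist_norm power2_less_imp_less)
    qed
  qed
  then obtain k where k: "s \<longlonglongrightarrow> k" using Cauchy_convergent convergent_def by blast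
  have kX: "k \<in> closure X" using k s(1) closure_sequential by blast
  have Jlim: "(\<lambda>n. J (s n)) \<longlonglongrightarrow> m"
  proof (rule tendsto_sandwich[of "\<lambda>_. m" _ _ "\<lambda>n. m + 1 / real (Suc n)"])
    have "(\<lambda>n. m + 1 / real (Suc n)) \<longlonglongrightarrow> m + 0"
      by (intro tendsto_add tendsto_const) (rule LIMSEQ_Suc[OF lim_1_over_n])
    then show "(\<lambda>n. m + 1 / real (Suc n)) \<longlonglongrightarrow> m" by simp
  qed (use s m in \<open>auto intro!: always_eventually less_imp_le\<close>)
  have "f x = x \<bullet> k" if x: "x \<in> X" for x
  proof -
    \<comment> \<open>As \<open>k\<close> may lie outside \<open>X\<close>, the variation in
      direction \<open>x\<close> is carried out at \<open>s n\<close>, and only the resulting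
      inequality is passed to the limit.\<close>
    have "0 \<le> 2 * t * (x \<bullet> k - f x) + t\<^sup>2 * (norm x)\<^sup>2" for t
    proof -
      have "m \<le> J (s n) + 2 * t * (x \<bullet> s n - f x) + t\<^sup>2 * (norm x)\<^sup>2" for n
      proof -
        have "m \<le> J (s n + t *\<^sub>R x)"
          using X x s(1) by (intro m subspace_add subspace_scale)
        also have "\<dots> = J (s n) + 2 * t * (x \<bullet> s n - f x) + t\<^sup>2 * (norm x)\<^sup>2"
          using x s(1) subspace_scale[OF X]
          by (simp add: J_def add scale power2_norm_eq_inner inner_simps inner_commute algebra_simps)
            (simp add: power2_eq_square)
        finally show ?thesis .
      qed
      moreover have "(\<lambda>n. J (s n) + 2 * t * (x \<bullet> s n - f x) + t\<^sup>2 * (norm x)\<^sup>2)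
          \<longlonglongrightarrow> m + 2 * t * (x \<bullet> k - f x) + t\<^sup>2 * (norm x)\<^sup>2"
        by (intro tendsto_intros Jlim k)
      ultimately have "m \<le> m + 2 * t * (x \<bullet> k - f x) + t\<^sup>2 * (norm x)\<^sup>2"
        by (intro LIMSEQ_le_const) auto
      then show ?thesis by simp
    qed
    then have "x \<bullet> k - f x = 0" by (rule linear_coeff_zero_of_quadratic_nonneg)
    then show ?thesis by simp
  qed
  with kX show ?thesis by blast
qed

section \<open>Orthogonal projections onto closed subspaces\<close>

definition orth_proj :: "'a::real_inner set \<Rightarrow> 'a \<Rightarrow> 'a" where
  "orth_proj G z = (THE p. p \<in> G \<and> (\<forall>g\<in>G. (z - p) \<bullet> g = 0))"

lemma orth_proj_eqI:
  assumes G: "subspace G" and p: "p \<in> G" "\<And>g. g \<in> G \<Longrightarrow> (z - p) \<bullet> g = 0"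
  shows "orth_proj G z = p"
  unfolding orth_proj_def
proof (rule the_equality)
  fix q assume q: "q \<in> G \<and> (\<forall>g\<in>G. (z - q) \<bullet> g = 0)"
  have "p - q \<in> G" using G p q by (simp add: subspace_diff)
  then have "(p - q) \<bullet> (p - q) = 0"
    using p(2)[of "p - q"] q by (simp add: inner_diff_left)
  then show "q = p" by simp
qed (use p in auto)

context
  fixes G :: "'a::{real_inner,complete_space} set"
  assumes subspace: "subspace G" and closed: "closed G"
begin

text \<open>The projection of \<open>z\<close> is the Riesz vector of the functional
  \<open>x \<bullet> z\<close> restricted to \<open>G\<close>; closedness of \<open>G\<close> keeps
  this vector inside \<open>G\<close>.\<close>

lemma orth_proj_in: "orth_proj G z \<in> G"
  and orth_proj_orthogonal: "g \<in> G \<Longrightarrow> (z - orth_proj G z) \<bullet> g = 0"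
proof -
  have "\<exists>k\<in>closure G. \<forall>x\<in>G. x \<bullet> z = x \<bullet> k"
    by (rule riesz_representation_subspace[OF subspace, of _ "norm z"])
      (auto simp: inner_simps mult.commute[of "norm z"] Cauchy_Schwarz_ineq2)
  then obtain k where k: "k \<in> G" "\<And>x. x \<in> G \<Longrightarrow> x \<bullet> z = x \<bullet> k"
    using closed by auto
  have "orth_proj G z = k"
    by (rule orth_proj_eqI[OF subspace k(1)])
      (use k(2) in \<open>simp add: inner_diff_right inner_commute\<close>)
  then show "orth_proj G z \<in> G" "g \<in> G \<Longrightarrow> (z - orth_proj G z) \<bullet> g = 0"
    using k by (auto simp: inner_diff_right inner_commute[of _ g])
qed

lemma orth_proj_inner_left: "g \<in> G \<Longrightarrow> orth_proj G z \<bullet> g = z \<bullet> g"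
  using orth_proj_orthogonal[of g z] by (simp add: inner_diff_left)

lemma orth_proj_ident: "g \<in> G \<Longrightarrow> orth_proj G g = g"
  by (rule orth_proj_eqI[OF subspace]) auto

lemma orth_proj_selfadjoint: "orth_proj G z \<bullet> w = z \<bullet> orth_proj G w"
  by (metis orth_proj_in orth_proj_inner_left inner_commute)

text \<open>\<open>G\<close> reduces \<open>W\<close>: since the adjoint \<open>W'\<close> preserves
  \<open>G\<close>, \<open>W\<close> preserves the orthogonal complement of \<open>G\<close> as
  well.\<close>

lemma orth_proj_commute:
  assumes "linear W" and "\<And>x y. W x \<bullet> y = x \<bullet> W' y"
    and "W ` G \<subseteq> G" and "W' ` G \<subseteq> G"
  shows "orth_proj G (W z) = W (orth_proj G z)"
proof (rule orth_proj_eqI[OF subspace])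
  show "W (orth_proj G z) \<in> G" using assms(3) orth_proj_in by auto
  fix g assume "g \<in> G"
  then have "W' g \<in> G" using assms(4) by auto
  then show "(W z - W (orth_proj G z)) \<bullet> g = 0"
    by (simp add: orth_proj_orthogonal assms(2) flip: linear_diff[OF assms(1)])
qed

lemma norm_orth_proj_le: "norm (orth_proj G z) \<le> norm z"
proof -
  have "(norm (orth_proj G z))\<^sup>2 = z \<bullet> orth_proj G z"
    by (simp add: power2_norm_eq_inner orth_proj_inner_left orth_proj_in)
  also have "\<dots> \<le> norm z * norm (orth_proj G z)"
    by (rule norm_cauchy_schwarz)
  finally show ?thesis
    by (metis mult_right_le_imp_le norm_ge_zero order_le_less power2_eq_square)
qed

lemma bounded_linear_orth_proj: "bounded_linear (orth_proj G)"
proof (rule bounded_linear_intro[where K = 1])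
  show "orth_proj G (x + y) = orth_proj G x + orth_proj G y" for x y
    by (rule orth_proj_eqI[OF subspace])
      (auto simp: subspace_add[OF subspace] orth_proj_in inner_simps orth_proj_inner_left)
  show "orth_proj G (r *\<^sub>R x) = r *\<^sub>R orth_proj G x" for r x
    by (rule orth_proj_eqI[OF subspace])
      (auto simp: subspace_scale[OF subspace] orth_proj_in inner_simps orth_proj_inner_left)
qed (simp add: norm_orth_proj_le)

end

text \<open>The core of Douglas' argument, with \<open>R\<close> the adjoint of \<open>L\<close>.
  The bound lets the functional \<open>x \<bullet> y\<close> descend to a bounded functional on
  \<open>range L\<close>, and a vector \<open>k\<close> representing it satisfies
  \<open>y = R k\<close>.\<close>

lemma range_adjoint_iff:
  fixes L :: "'a::real_inner \<Rightarrow> 'b::{real_inner,complete_space}"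
  assumes L: "linear L" and R: "\<And>x k. L x \<bullet> k = x \<bullet> R k"
  shows "y \<in> range R \<longleftrightarrow> (\<exists>C. \<forall>x. \<bar>x \<bullet> y\<bar> \<le> C * norm (L x))"
proof
  assume "y \<in> range R"
  then obtain k where "y = R k" by auto
  then have "\<bar>x \<bullet> y\<bar> \<le> norm k * norm (L x)" for x
    using Cauchy_Schwarz_ineq2[of "L x" k] by (simp add: R mult.commute)
  then show "\<exists>C. \<forall>x. \<bar>x \<bullet> y\<bar> \<le> C * norm (L x)" by blast
next
  assume "\<exists>C. \<forall>x. \<bar>x \<bullet> y\<bar> \<le> C * norm (L x)"
  then obtain C where C: "\<And>x. \<bar>x \<bullet> y\<bar> \<le> C * norm (L x)" by blast
  \<comment> \<open>\<open>inv L\<close> picks an arbitrary preimage; the value is independent of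
    the choice because the bound makes \<open>y\<close> orthogonal to the kernel of
    \<open>L\<close>.\<close>
  define f where "f u = inv L u \<bullet> y" for u
  have f: "f (L x) = x \<bullet> y" for x
  proof -
    have "L (inv L (L x)) = L x" by (simp add: f_inv_into_f)
    then have "\<bar>(inv L (L x) - x) \<bullet> y\<bar> \<le> 0"
      using C[of "inv L (L x) - x"] by (simp add: linear_diff[OF L])
    then show ?thesis by (simp add: f_def inner_diff_left)
  qed
  have "\<exists>k\<in>closure (range L). \<forall>u\<in>range L. f u = u \<bullet> k"
  proof (rule riesz_representation_subspace[where C = C])
    show "subspace (range L)" using L by (simp add: linear_subspace_image)
  qed (auto simp: f C inner_simps simp flip: linear_add[OF L] linear_scale[OF L])
  then obtain k where "\<And>x. x \<bullet> y = x \<bullet> R k" by (auto simp: f R)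
  then have "y = R k" by (metis vector_eq_ldot)
  then show "y \<in> range R" by simp
qed

text \<open>The criterion of \<open>range_adjoint_iff\<close> sees \<open>L\<close> only through
  \<open>norm (L x)\<close>, so the two codomains may differ. This later compares a square root on
  the space with a projection in its double.\<close>

lemma range_adjoint_eq:
  fixes L :: "'a::real_inner \<Rightarrow> 'b::{real_inner,complete_space}"
    and L' :: "'a \<Rightarrow> 'c::{real_inner,complete_space}"
  assumes "linear L" "\<And>x k. L x \<bullet> k = x \<bullet> R k"
    and "linear L'" "\<And>x k. L' x \<bullet> k = x \<bullet> R' k"
    and "\<And>x. norm (L x) = norm (L' x)"
  shows "range R = range R'"
  unfolding set_eq_iff range_adjoint_iff[OF assms(1,2)] range_adjoint_iff[OF assms(3,4)] assms(5)
  by simp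
section \<open>Square roots of positive contractions\<close>

text \<open>
  For a contraction \<open>B\<close>, the iteration \<open>Y \<mapsto> (B + Y\<^sup>2) / 2\<close> converges to a fixed point, for which
  \<open>(1 - Y)\<^sup>2 = 1 - B\<close>. The increments are dominated in norm by those of the same iteration for the
  scalar \<open>B = 1\<close>, which is increasing and bounded by \<open>1\<close>.
\<close>

primrec sqrt_iter :: "('a::real_vector \<Rightarrow> 'a) \<Rightarrow> nat \<Rightarrow> 'a \<Rightarrow> 'a" where
  "sqrt_iter B 0 x = 0"
| "sqrt_iter B (Suc n) x = (1/2) *\<^sub>R (B x + sqrt_iter B n (sqrt_iter B n x))"

primrec sqrt_majorant :: "nat \<Rightarrow> real" where
  "sqrt_majorant 0 = 0"
| "sqrt_majorant (Suc n) = (1 + (sqrt_majorant n)\<^sup>2) / 2"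

lemma sqrt_majorant_bounds: "0 \<le> sqrt_majorant n \<and> sqrt_majorant n \<le> 1"
  by (induction n) (auto simp: power_le_one)

lemma sqrt_majorant_Suc_le: "sqrt_majorant n \<le> sqrt_majorant (Suc n)"
proof -
  have "0 \<le> (1 - sqrt_majorant n)\<^sup>2" by simp
  then show ?thesis by (simp add: power2_diff)
qed

lemma convergent_sqrt_majorant: "convergent sqrt_majorant"
proof (rule Bseq_mono_convergent)
  show "Bseq sqrt_majorant"
    using sqrt_majorant_bounds by (intro BseqI'[where K = 1]) auto
  show "\<forall>m. \<forall>n\<ge>m. sqrt_majorant m \<le> sqrt_majorant n"
    using lift_Suc_mono_le[of sqrt_majorant] sqrt_majorant_Suc_le by blast
qed

context
  fixes B :: "'a::{real_normed_vector,complete_space} \<Rightarrow> 'a"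
  assumes linB: "bounded_linear B" and contraction: "\<And>x. norm (B x) \<le> norm x"
begin

lemma linear_sqrt_iter: "linear (sqrt_iter B n)"
  using bounded_linear.linear[OF linB]
  by (induction n) (auto simp: linear_iff algebra_simps)

lemma norm_sqrt_iter_le: "norm (sqrt_iter B n x) \<le> sqrt_majorant n * norm x"
proof (induction n arbitrary: x)
  case (Suc n)
  let ?Y = "sqrt_iter B n" and ?y = "sqrt_majorant n"
  have "norm (?Y (?Y x)) \<le> ?y * (?y * norm x)"
    by (rule order_trans[OF Suc mult_left_mono[OF Suc]]) (use sqrt_majorant_bounds in simp)
  then have "norm (B x + ?Y (?Y x)) \<le> norm x + ?y\<^sup>2 * norm x"
    using norm_triangle_ineq[of "B x" "?Y (?Y x)"] contraction[of x]
    by (simp add: power2_eq_square)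
  then show ?case
    unfolding sqrt_iter.simps sqrt_majorant.simps norm_scaleR by (simp add: field_simps)
qed simp

text \<open>With consecutive iterates \<open>Y\<close> and \<open>Y'\<close>, the next increment is
  half of \<open>Y' (Y' - Y) + (Y' - Y) Y\<close>, a splitting that does not require
  \<open>Y\<close> and \<open>Y'\<close> to commute. Bounding each factor by its scalar counterpart
  gives \<open>(y'\<^sup>2 - y\<^sup>2) / 2\<close>.\<close>

lemma norm_sqrt_iter_Suc_diff_le:
  "norm (sqrt_iter B (Suc n) x - sqrt_iter B n x)
    \<le> (sqrt_majorant (Suc n) - sqrt_majorant n) * norm x"
proof (induction n arbitrary: x)
  case (Suc n)
  define Y Y' where "Y = sqrt_iter B n" and "Y' = sqrt_iter B (Suc n)"
  define y y' where "y = sqrt_majorant n" and "y' = sqrt_majorant (Suc n)"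
  have Y'_diff: "Y' (u - v) = Y' u - Y' v" for u v
    unfolding Y'_def by (rule linear_diff[OF linear_sqrt_iter])
  have y: "0 \<le> y'" "y \<le> y'" "y' = (1 + y\<^sup>2) / 2" "sqrt_majorant (Suc (Suc n)) = (1 + y'\<^sup>2) / 2"
    unfolding y_def y'_def using sqrt_majorant_bounds sqrt_majorant_Suc_le by auto
  have Y: "norm (Y u) \<le> y * norm u" "norm (Y' u) \<le> y' * norm u"
    "norm (Y' u - Y u) \<le> (y' - y) * norm u" for u
    unfolding Y_def Y'_def y_def y'_def by (rule norm_sqrt_iter_le Suc)+
  have "sqrt_iter B (Suc (Suc n)) x = (1/2) *\<^sub>R (B x + Y' (Y' x))"
    and Y'x: "Y' x = (1/2) *\<^sub>R (B x + Y (Y x))"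
    unfolding Y_def Y'_def by (rule sqrt_iter.simps)+
  then have "sqrt_iter B (Suc (Suc n)) x - Y' x = (1/2) *\<^sub>R (Y' (Y' x) - Y (Y x))"
    by (metis add_diff_cancel_left scaleR_diff_right)
  then have eq: "sqrt_iter B (Suc (Suc n)) x - Y' x
      = (1/2) *\<^sub>R (Y' (Y' x - Y x) + (Y' (Y x) - Y (Y x)))"
    by (simp add: Y'_diff)
  have "norm (Y' (Y' x - Y x)) \<le> y' * ((y' - y) * norm x)"
    by (rule order_trans[OF Y(2) mult_left_mono[OF Y(3)]]) (rule y)
  moreover have "norm (Y' (Y x) - Y (Y x)) \<le> (y' - y) * (y * norm x)"
    by (rule order_trans[OF Y(3) mult_left_mono[OF Y(1)]]) (use y in simp)
  ultimately have "norm (Y' (Y' x - Y x) + (Y' (Y x) - Y (Y x)))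
      \<le> y' * ((y' - y) * norm x) + (y' - y) * (y * norm x)"
    by (rule norm_triangle_mono)
  also have "\<dots> = (y'\<^sup>2 - y\<^sup>2) * norm x"
    by (simp add: power2_eq_square algebra_simps)
  finally have "norm (sqrt_iter B (Suc (Suc n)) x - Y' x) \<le> (y'\<^sup>2 - y\<^sup>2) / 2 * norm x"
    unfolding eq by simp
  also have "(y'\<^sup>2 - y\<^sup>2) / 2 = sqrt_majorant (Suc (Suc n)) - y'"
    unfolding y(4) by (subst (2) y(3)) (simp add: field_simps)
  finally show ?case unfolding Y'_def y'_def .
qed (use contraction in simp)

lemma norm_sqrt_iter_diff_le:
  "norm (sqrt_iter B (n + k) x - sqrt_iter B n x)
    \<le> (sqrt_majorant (n + k) - sqrt_majorant n) * norm x"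
proof (induction k)
  case (Suc k)
  then show ?case
    using norm_triangle_mono[OF norm_sqrt_iter_Suc_diff_le[of "n + k" x] Suc]
    by (simp add: algebra_simps del: sqrt_iter.simps sqrt_majorant.simps)
qed simp

lemma convergent_sqrt_iter: "convergent (\<lambda>n. sqrt_iter B n x)"
proof -
  have "Cauchy (\<lambda>n. sqrt_majorant n * norm x)"
    using convergent_sqrt_majorant
    by (intro convergent_Cauchy convergent_mult convergent_const)
  then have "Cauchy (\<lambda>n. sqrt_iter B n x)"
    unfolding Cauchy_altdef2
  proof (intro allI impI)
    fix e :: real
    assume "\<forall>e>0. \<exists>N. \<forall>n\<ge>N. dist (sqrt_majorant n * norm x) (sqrt_majorant N * norm x) < e"
      and "e > 0"
    then obtain N where
      N: "\<And>n. n \<ge> N \<Longrightarrow> dist (sqrt_majorant n * norm x) (sqrt_majorant N * norm x) < e"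
      by blast
    have "dist (sqrt_iter B n x) (sqrt_iter B N x) < e" if n: "n \<ge> N" for n
      using N[OF n] norm_sqrt_iter_diff_le[of N "n - N" x] n
      by (simp add: dist_norm algebra_simps)
    then show "\<exists>N. \<forall>n\<ge>N. dist (sqrt_iter B n x) (sqrt_iter B N x) < e" by blast
  qed
  then show ?thesis by (rule Cauchy_convergent)
qed

definition sqrt_limit :: "'a \<Rightarrow> 'a" where
  "sqrt_limit x = lim (\<lambda>n. sqrt_iter B n x)"

lemma tendsto_sqrt_limit: "(\<lambda>n. sqrt_iter B n x) \<longlonglongrightarrow> sqrt_limit x"
  unfolding sqrt_limit_def using convergent_sqrt_iter convergent_LIMSEQ_iff by blast

lemma norm_sqrt_iter_le_norm: "norm (sqrt_iter B n x) \<le> norm x"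
  using norm_sqrt_iter_le[of n x] sqrt_majorant_bounds[of n]
  by (meson mult_left_le_one_le norm_ge_zero order_trans)

lemma bounded_linear_sqrt_limit: "bounded_linear sqrt_limit"
proof (rule bounded_linear_intro[where K = 1])
  fix x y r
  have "(\<lambda>n. sqrt_iter B n (x + y)) \<longlonglongrightarrow> sqrt_limit x + sqrt_limit y"
    unfolding linear_add[OF linear_sqrt_iter] by (intro tendsto_intros tendsto_sqrt_limit)
  then show "sqrt_limit (x + y) = sqrt_limit x + sqrt_limit y"
    using LIMSEQ_unique tendsto_sqrt_limit by blast
  have "(\<lambda>n. sqrt_iter B n (r *\<^sub>R x)) \<longlonglongrightarrow> r *\<^sub>R sqrt_limit x"
    unfolding linear_scale[OF linear_sqrt_iter] by (intro tendsto_intros tendsto_sqrt_limit)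
  then show "sqrt_limit (r *\<^sub>R x) = r *\<^sub>R sqrt_limit x"
    using LIMSEQ_unique tendsto_sqrt_limit by blast
  have "norm (sqrt_limit x) \<le> norm x"
    using tendsto_norm[OF tendsto_sqrt_limit[of x]] norm_sqrt_iter_le_norm[of _ x]
    by (intro LIMSEQ_le_const2) auto
  then show "norm (sqrt_limit x) \<le> norm x * 1" by simp
qed

lemma sqrt_limit_equation: "2 *\<^sub>R sqrt_limit x = B x + sqrt_limit (sqrt_limit x)"
proof -
  \<comment> \<open>Both the operator and its argument vary with \<open>n\<close>; the iterates are
    contractions uniformly in \<open>n\<close>, so the error from moving the argument
    vanishes.\<close>
  have "(\<lambda>n. sqrt_iter B n (sqrt_iter B n x - sqrt_limit x)) \<longlonglongrightarrow> 0"
  proof (rule Lim_null_comparison)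
    show "(\<lambda>n. norm (sqrt_iter B n x - sqrt_limit x)) \<longlonglongrightarrow> 0"
      using tendsto_sqrt_limit[of x] LIM_zero tendsto_norm_zero by blast
  qed (simp add: norm_sqrt_iter_le_norm)
  from tendsto_add[OF this tendsto_sqrt_limit[of "sqrt_limit x"]]
  have "(\<lambda>n. sqrt_iter B n (sqrt_iter B n x)) \<longlonglongrightarrow> sqrt_limit (sqrt_limit x)"
    by (simp add: linear_diff[OF linear_sqrt_iter])
  then have "(\<lambda>n. sqrt_iter B (Suc n) x) \<longlonglongrightarrow> (1/2) *\<^sub>R (B x + sqrt_limit (sqrt_limit x))"
    by (auto intro!: tendsto_intros)
  with LIMSEQ_Suc[OF tendsto_sqrt_limit[of x]]
  have "sqrt_limit x = (1/2) *\<^sub>R (B x + sqrt_limit (sqrt_limit x))"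
    by (rule LIMSEQ_unique)
  then have "2 *\<^sub>R sqrt_limit x = 2 *\<^sub>R ((1/2) *\<^sub>R (B x + sqrt_limit (sqrt_limit x)))"
    by (rule arg_cong)
  also have "\<dots> = B x + sqrt_limit (sqrt_limit x)"
    by (simp only: scaleR_scaleR) simp
  finally show ?thesis .
qed

text \<open>Every iterate is a polynomial in \<open>B\<close>, hence commutes with \<open>C\<close>,
  and continuity of \<open>C\<close> carries this to the limit.\<close>

lemma sqrt_limit_commute:
  assumes C: "bounded_linear C" and comm: "\<And>x. C (B x) = B (C x)"
  shows "C (sqrt_limit x) = sqrt_limit (C x)"
proof -
  interpret C: bounded_linear C by (rule C)
  have iter: "C (sqrt_iter B n x) = sqrt_iter B n (C x)" for n x
    by (induction n arbitrary: x) (simp_all add: C.zero C.add C.scaleR comm)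
  have "(\<lambda>n. sqrt_iter B n (C x)) \<longlonglongrightarrow> C (sqrt_limit x)"
    unfolding iter[symmetric] by (intro C.tendsto tendsto_sqrt_limit)
  then show ?thesis using LIMSEQ_unique tendsto_sqrt_limit by blast
qed

end

lemma sqrt_limit_selfadjoint:
  fixes B :: "'a::{real_inner,complete_space} \<Rightarrow> 'a"
  assumes "bounded_linear B" and "\<And>x. norm (B x) \<le> norm x"
    and selfadjoint: "\<And>x y. B x \<bullet> y = x \<bullet> B y"
  shows "sqrt_limit B x \<bullet> y = x \<bullet> sqrt_limit B y"
proof -
  have iter: "sqrt_iter B n x \<bullet> y = x \<bullet> sqrt_iter B n y" for n x y
    by (induction n arbitrary: x y) (simp_all add: inner_simps selfadjoint)
  have "(\<lambda>n. sqrt_iter B n x \<bullet> y) \<longlonglongrightarrow> x \<bullet> sqrt_limit B y"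
    unfolding iter by (intro tendsto_intros tendsto_sqrt_limit[OF assms(1,2)])
  moreover have "(\<lambda>n. sqrt_iter B n x \<bullet> y) \<longlonglongrightarrow> sqrt_limit B x \<bullet> y"
    by (intro tendsto_intros tendsto_sqrt_limit[OF assms(1,2)])
  ultimately show ?thesis using LIMSEQ_unique by blast
qed

text \<open>The root is \<open>1 - Y\<close>, where \<open>Y\<close> is the limit for
  \<open>B = 1 - A\<close>. The commutation clause later yields complex linearity of the root and
  its membership in the algebra.\<close>

lemma exists_operator_sqrt:
  fixes A :: "'a::{real_inner,complete_space} \<Rightarrow> 'a"
  assumes A: "bounded_linear A" and selfadjoint: "\<And>x y. A x \<bullet> y = x \<bullet> A y"
    and nonneg: "\<And>x. 0 \<le> A x \<bullet> x" and le_one: "\<And>x. A x \<bullet> x \<le> x \<bullet> x"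
  shows "\<exists>S. bounded_linear S \<and> (\<forall>x y. S x \<bullet> y = x \<bullet> S y) \<and> (\<forall>x. S (S x) = A x) \<and>
    (\<forall>C. bounded_linear C \<longrightarrow> (\<forall>x. C (A x) = A (C x)) \<longrightarrow> (\<forall>x. C (S x) = S (C x)))"
proof -
  interpret A: bounded_linear A by (rule A)
  define B where "B x = x - A x" for x
  have B: "bounded_linear B"
    unfolding B_def by (intro bounded_linear_sub A bounded_linear_ident)
  \<comment> \<open>Positivity at \<open>x - A x\<close> and the upper bound at \<open>A x\<close>
    give \<open>A x \<bullet> A x \<le> A x \<bullet> x\<close>, from which the contraction property
    follows by expanding \<open>B x \<bullet> B x\<close>.\<close>
  have contraction: "norm (B x) \<le> norm x" for x
  proof -
    have "0 \<le> A (x - A x) \<bullet> (x - A x)" by (rule nonneg)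
    also have "\<dots> = A x \<bullet> x - 2 * (A x \<bullet> A x) + A (A x) \<bullet> A x"
      by (simp add: A.diff inner_simps selfadjoint)
    finally have "A x \<bullet> A x \<le> A x \<bullet> x" using le_one[of "A x"] by simp
    then have "B x \<bullet> B x \<le> x \<bullet> x"
      using nonneg[of x] by (simp add: B_def inner_simps inner_commute)
    then show ?thesis by (simp add: norm_le)
  qed
  have selfB: "B x \<bullet> y = x \<bullet> B y" for x y by (simp add: B_def inner_simps selfadjoint)
  let ?Y = "sqrt_limit B"
  interpret Y: bounded_linear ?Y by (rule bounded_linear_sqrt_limit[OF B contraction])
  show ?thesis
  proof (intro exI[of _ "\<lambda>x. x - ?Y x"] conjI)
    show "bounded_linear (\<lambda>x. x - ?Y x)"
      by (intro bounded_linear_sub Y.bounded_linear_axioms bounded_linear_ident)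
    show "\<forall>x y. (x - ?Y x) \<bullet> y = x \<bullet> (y - ?Y y)"
      by (simp add: inner_simps sqrt_limit_selfadjoint[OF B contraction selfB])
    show "\<forall>x. (x - ?Y x) - ?Y (x - ?Y x) = A x"
    proof
      fix x
      show "(x - ?Y x) - ?Y (x - ?Y x) = A x"
        using sqrt_limit_equation[OF B contraction, of x] B_def[of x]
        by (simp add: Y.diff scaleR_2 algebra_simps)
    qed
    show "\<forall>C. bounded_linear C \<longrightarrow> (\<forall>x. C (A x) = A (C x)) \<longrightarrow>
        (\<forall>x. C (x - ?Y x) = C x - ?Y (C x))"
    proof (intro allI impI)
      fix C x assume C: "bounded_linear C" "\<forall>x. C (A x) = A (C x)"
      then interpret C: bounded_linear C by simp
      have "C (?Y x) = ?Y (C x)"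
        by (rule sqrt_limit_commute[OF B contraction C(1)]) (simp add: B_def C.diff C(2))
      then show "C (x - ?Y x) = C x - ?Y (C x)" by (simp add: C.diff)
    qed
  qed
qed

section \<open>Adjoints, unitaries and commutants\<close>

lemma imaginary_imaginary: "\<i> *\<^sub>C \<i> *\<^sub>C x = - (x :: 'h::complex_hilbert)"
  using scaleR_scaleC[of "- 1" x] by (simp add: scaleC_scaleC)

lemma scaleC_eq_scaleR: "c *\<^sub>C x = Re c *\<^sub>R x + Im c *\<^sub>R \<i> *\<^sub>C (x :: 'h::complex_hilbert)"
proof -
  have "c *\<^sub>C x = (complex_of_real (Re c) + complex_of_real (Im c) * \<i>) *\<^sub>C x"
    by (simp add: complex_eq mult.commute)
  then show ?thesis by (simp add: scaleC_add_left scaleC_scaleC scaleR_scaleC)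
qed

lemma Im_cinner: "Im (cinner x y) = - ((\<i> *\<^sub>C x) \<bullet> (y :: 'h::complex_hilbert))"
  by (simp add: inner_eq_Re_cinner cinner_scaleC_left)

lemma inner_imaginary_left: "(\<i> *\<^sub>C x) \<bullet> y = - (x \<bullet> \<i> *\<^sub>C (y :: 'h::complex_hilbert))"
proof -
  have "Im (cinner y x) = - Im (cinner x y)" by (subst cinner_commute) simp
  then show ?thesis using Im_cinner[of x y] Im_cinner[of y x] by (simp add: inner_commute)
qed

lemma norm_imaginary: "norm (\<i> *\<^sub>C x) = norm (x :: 'h::complex_hilbert)"
  by (simp add: norm_eq inner_imaginary_left imaginary_imaginary)

lemma bounded_linear_imaginary: "bounded_linear (\<lambda>x :: 'h::complex_hilbert. \<i> *\<^sub>C x)"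
  by (rule bounded_linear_intro[where K = 1])
    (simp_all add: scaleC_add_right scaleR_scaleC scaleC_scaleC mult.commute norm_imaginary)

text \<open>The imaginary part of \<open>cinner\<close> is a real inner product with the first
  argument multiplied by the imaginary unit, so for such \<open>T\<close> the real adjoint identity
  already contains the complex one.\<close>

lemma cinner_adjoint_iff:
  assumes "\<And>x. T (\<i> *\<^sub>C x) = \<i> *\<^sub>C T x"
  shows "(\<forall>x y. cinner (T x) y = cinner x (S y)) \<longleftrightarrow> (\<forall>x y :: 'h::complex_hilbert. T x \<bullet> y = x \<bullet> S y)"
  unfolding complex_eq_iff Im_cinner by (simp add: assms[symmetric] flip: inner_eq_Re_cinner) blast

lemma bounded_operators_iff:
  "T \<in> bounded_operators \<longleftrightarrow>
    bounded_linear T \<and> (\<forall>x :: 'h::complex_hilbert. T (\<i> *\<^sub>C x) = \<i> *\<^sub>C T x)"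
proof
  assume T: "bounded_linear T \<and> (\<forall>x. T (\<i> *\<^sub>C x) = \<i> *\<^sub>C T x)"
  then interpret T: bounded_linear T by simp
  have "T (c *\<^sub>C x) = c *\<^sub>C T x" for c x
    unfolding scaleC_eq_scaleR[of c] T.add T.scaleR using T by simp
  then show "T \<in> bounded_operators"
    using T unfolding bounded_operators_def Vector_Spaces.linear_iff
    by (blast intro: T.add cvec.vector_space_axioms)
qed (unfold bounded_operators_def Vector_Spaces.linear_iff, blast)

lemma bounded_operatorsD:
  assumes "T \<in> bounded_operators"
  shows "bounded_linear T" "T (\<i> *\<^sub>C x) = \<i> *\<^sub>C T x"
  using assms by (auto simp: bounded_operators_iff)

lemma exists_real_adjoint:
  fixes T :: "'a::{real_inner,complete_space} \<Rightarrow> 'a"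
  assumes "bounded_linear T"
  obtains S where "\<And>x y. T x \<bullet> y = x \<bullet> S y"
proof -
  interpret T: bounded_linear T by (rule assms)
  obtain K where K: "\<And>x. norm (T x) \<le> norm x * K" using T.bounded by blast
  have "\<exists>k. \<forall>x. T x \<bullet> y = x \<bullet> k" for y
  proof -
    have "\<bar>T x \<bullet> y\<bar> \<le> (norm y * K) * norm x" for x
    proof -
      have "\<bar>T x \<bullet> y\<bar> \<le> norm (T x) * norm y" by (rule Cauchy_Schwarz_ineq2)
      also have "\<dots> \<le> (norm x * K) * norm y" by (intro mult_right_mono K) simp
      finally show ?thesis by (simp add: ac_simps)
    qed
    then show ?thesis
      using riesz_representation_subspace[OF subspace_UNIV, of "\<lambda>x. T x \<bullet> y" "norm y * K"]
      by (simp add: T.add T.scaleR inner_simps)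
  qed
  then show ?thesis using that by metis
qed

lemma cadjoint_unique:
  assumes "T \<in> bounded_operators" and "\<And>x y. T x \<bullet> y = x \<bullet> S y"
  shows "cadjoint T = S"
  unfolding cadjoint_def cinner_adjoint_iff[of T, OF bounded_operatorsD(2)[OF assms(1)]]
proof (rule the_equality)
  fix S' assume "\<forall>x y. T x \<bullet> y = x \<bullet> S' y"
  then show "S' = S" using assms(2) by (metis ext vector_eq_ldot)
qed (use assms in blast)

lemma cadjoint_inner:
  assumes T: "T \<in> bounded_operators"
  shows "T x \<bullet> y = x \<bullet> cadjoint T y"
  by (rule exists_real_adjoint[OF bounded_operatorsD(1)[OF T]]) (metis T cadjoint_unique)

lemma cadjoint_inner_left:
  assumes "T \<in> bounded_operators"
  shows "cadjoint T x \<bullet> y = x \<bullet> T y"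
  using cadjoint_inner[OF assms, of y x] by (simp add: inner_commute)

lemma cadjoint_bounded_operator:
  assumes T: "T \<in> bounded_operators"
  shows "cadjoint T \<in> bounded_operators"
proof -
  interpret T: bounded_linear T by (rule bounded_operatorsD[OF T])
  note adj = cadjoint_inner[OF T, symmetric]
  obtain K where K: "K \<ge> 0" "\<And>x. norm (T x) \<le> norm x * K" using T.nonneg_bounded by blast
  have "bounded_linear (cadjoint T)"
  proof (rule bounded_linear_intro[where K = K])
    show "cadjoint T (x + y) = cadjoint T x + cadjoint T y" for x y
      by (subst vector_eq_ldot[symmetric]) (simp add: inner_simps adj)
    show "cadjoint T (r *\<^sub>R x) = r *\<^sub>R cadjoint T x" for r x
      by (subst vector_eq_ldot[symmetric]) (simp add: adj)
    show "norm (cadjoint T x) \<le> norm x * K" for x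
    proof -
      have "(norm (cadjoint T x))\<^sup>2 = T (cadjoint T x) \<bullet> x"
        by (simp add: power2_norm_eq_inner adj)
      also have "\<dots> \<le> norm (T (cadjoint T x)) * norm x" by (rule norm_cauchy_schwarz)
      also have "\<dots> \<le> (norm (cadjoint T x) * K) * norm x" by (intro mult_right_mono K) simp
      finally have "norm (cadjoint T x) * norm (cadjoint T x) \<le> norm (cadjoint T x) * (norm x * K)"
        by (simp add: power2_eq_square ac_simps)
      then show ?thesis using K(1) by (cases "norm (cadjoint T x) = 0") auto
    qed
  qed
  moreover have "cadjoint T (\<i> *\<^sub>C x) = \<i> *\<^sub>C cadjoint T x" for x
  proof -
    have "u \<bullet> cadjoint T (\<i> *\<^sub>C x) = u \<bullet> \<i> *\<^sub>C cadjoint T x" for u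
      using inner_imaginary_left[of u "cadjoint T x"] inner_imaginary_left[of "T u" x]
      by (simp add: adj bounded_operatorsD(2)[OF T])
    then show ?thesis by (metis vector_eq_ldot)
  qed
  ultimately show ?thesis by (simp add: bounded_operators_iff)
qed

lemma unitaryI:
  assumes "U \<in> bounded_operators" and "\<And>x y. U x \<bullet> y = x \<bullet> V y"
    and "\<And>x. V (U x) = x" and "\<And>x. U (V x) = x"
  shows "unitary U"
  using assms cadjoint_unique[OF assms(1,2)] by (auto simp: unitary_def)

lemma unitaryD:
  assumes "unitary U"
  shows "U \<in> bounded_operators" "cadjoint U (U x) = x" "U (cadjoint U x) = x"
  using assms by (auto simp: unitary_def fun_eq_iff)

lemma unitary_cadjoint:
  assumes "unitary U"
  shows "unitary (cadjoint U)"
  using unitaryD[OF assms]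
  by (intro unitaryI[where V = U]) (auto simp: cadjoint_bounded_operator cadjoint_inner_left)

section \<open>Commutants and their unitaries\<close>

lemma commutantI:
  assumes "T \<in> bounded_operators" and "\<And>S x. S \<in> N \<Longrightarrow> S (T x) = T (S x)"
  shows "T \<in> commutant N"
  using assms by (auto simp: commutant_def)

lemma commutantD:
  assumes "T \<in> commutant N"
  shows "T \<in> bounded_operators" "S \<in> N \<Longrightarrow> S (T x) = T (S x)"
  using assms by (auto simp: commutant_def fun_eq_iff)

text \<open>Take adjoints in the relation that \<open>T\<close> commutes with
  \<open>cadjoint S\<close>.\<close>

lemma commutant_cadjoint:
  assumes N: "N \<subseteq> bounded_operators" and star: "\<And>S. S \<in> N \<Longrightarrow> cadjoint S \<in> N"
    and T: "T \<in> commutant N"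
  shows "cadjoint T \<in> commutant N"
proof (rule commutantI)
  show "cadjoint T \<in> bounded_operators" using commutantD(1)[OF T] by (rule cadjoint_bounded_operator)
  fix S x assume S: "S \<in> N"
  have "u \<bullet> S (cadjoint T x) = u \<bullet> cadjoint T (S x)" for u
    using S N commutantD(2)[OF T star[OF S], of u]
    by (metis cadjoint_inner cadjoint_inner_left commutantD(1)[OF T] subsetD)
  then show "S (cadjoint T x) = cadjoint T (S x)" by (metis vector_eq_ldot)
qed

text \<open>
  A self-adjoint contraction \<open>T\<close> is the mean of the unitaries \<open>T + \<i> S\<close> and \<open>T - \<i> S\<close>,
  where \<open>S\<close> is a square root of \<open>1 - T\<^sup>2\<close>.
\<close>

lemma commutes_with_selfadjoint_contraction:
  fixes N :: "('h::complex_hilbert \<Rightarrow> 'h) set"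
  assumes N: "N \<subseteq> bounded_operators" and T: "T \<in> commutant N"
    and selfadjoint: "\<And>x y. T x \<bullet> y = x \<bullet> T y" and contraction: "\<And>x. norm (T x) \<le> norm x"
    and R: "linear R"
    and comm: "\<And>U x. U \<in> commutant N \<Longrightarrow> unitary U \<Longrightarrow> R (U x) = U (R x)"
  shows "R (T x) = T (R x)"
proof -
  note Top = commutantD(1)[OF T]
  interpret T: bounded_linear T by (rule bounded_operatorsD[OF Top])
  define A where "A = (\<lambda>x. x - T (T x))"
  have A: "bounded_linear A"
    unfolding A_def
    by (intro bounded_linear_sub bounded_linear_ident
        bounded_linear_compose[OF T.bounded_linear_axioms T.bounded_linear_axioms])
  have A_props: "A x \<bullet> y = x \<bullet> A y" "0 \<le> A x \<bullet> x" "A x \<bullet> x \<le> x \<bullet> x" for x y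
    using contraction[of x] inner_ge_zero[of "T x"]
    by (simp_all add: A_def inner_simps selfadjoint norm_le)
  obtain S where S: "bounded_linear S" "\<And>x y. S x \<bullet> y = x \<bullet> S y" "\<And>x. S (S x) = A x"
    and "\<forall>C. bounded_linear C \<longrightarrow> (\<forall>x. C (A x) = A (C x)) \<longrightarrow> (\<forall>x. C (S x) = S (C x))"
    using exists_operator_sqrt[OF A A_props] by blast
  then have S_comm: "C (S x) = S (C x)" if "bounded_linear C" "\<And>x. C (A x) = A (C x)" for C x
    using that by blast
  interpret S: bounded_linear S by (rule S)
  have S_comm_N: "Q (S x) = S (Q x)" if Q: "Q \<in> N" for Q x
  proof -
    have Qop: "Q \<in> bounded_operators" using Q N by auto
    interpret Q: bounded_linear Q by (rule bounded_operatorsD[OF Qop])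
    show ?thesis
      by (rule S_comm) (simp_all add: A_def Q.bounded_linear_axioms Q.diff commutantD(2)[OF T Q])
  qed
  have S_i: "S (\<i> *\<^sub>C x) = \<i> *\<^sub>C S x" for x
  proof -
    interpret i: bounded_linear "\<lambda>x :: 'h. \<i> *\<^sub>C x" by (rule bounded_linear_imaginary)
    show ?thesis
      by (rule S_comm[symmetric])
        (simp_all add: i.bounded_linear_axioms i.diff A_def bounded_operatorsD(2)[OF Top])
  qed
  have S_T: "T (S x) = S (T x)" for x
    by (rule S_comm) (simp_all add: T.bounded_linear_axioms A_def T.diff)
  \<comment> \<open>Both signs are treated at once. The adjoint is obtained by replacing
    \<open>r\<close> with \<open>- r\<close>, and both products reduce to
    \<open>T\<^sup>2 + S\<^sup>2 = 1\<close> because \<open>S\<close> commutes with \<open>T\<close>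
    and with the imaginary unit.\<close>
  have combination: "unitary (\<lambda>x. T x + r *\<^sub>R \<i> *\<^sub>C S x) \<and> (\<lambda>x. T x + r *\<^sub>R \<i> *\<^sub>C S x) \<in> commutant N"
    if r: "r * r = 1" for r :: real
  proof -
    interpret i: bounded_linear "\<lambda>x :: 'h. \<i> *\<^sub>C x" by (rule bounded_linear_imaginary)
    let ?U = "\<lambda>r x. T x + r *\<^sub>R \<i> *\<^sub>C S x"
    have U: "?U r \<in> bounded_operators" for r
      unfolding bounded_operators_iff
    proof (intro conjI allI)
      show "bounded_linear (?U r)"
        by (intro bounded_linear_add T.bounded_linear_axioms bounded_linear_const_scaleR
            bounded_linear_compose[OF bounded_linear_imaginary S(1)])
    qed (simp add: bounded_operatorsD(2)[OF Top] S_i scaleC_add_right i.scaleR)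
    have "?U (- r) (?U r x) = x" "?U r (?U (- r) x) = x" for x
      using r
      by (simp_all add: T.add T.diff T.neg T.scaleR S.add S.diff S.scaleR S.neg
          i.add i.diff i.neg i.scaleR S(3) A_def S_i S_T
          bounded_operatorsD(2)[OF Top] imaginary_imaginary scaleR_add_right scaleR_diff_right)
    moreover have "?U r x \<bullet> y = x \<bullet> ?U (- r) y" for x y
      by (simp add: inner_simps selfadjoint S(2) inner_imaginary_left S_i)
    ultimately have "unitary (?U r)" by (intro unitaryI U) auto
    moreover have "?U r \<in> commutant N"
    proof (rule commutantI[OF U])
      fix Q x assume Q: "Q \<in> N"
      then have Qop: "Q \<in> bounded_operators" using N by auto
      interpret Q: bounded_linear Q by (rule bounded_operatorsD[OF Qop])
      show "Q (?U r x) = ?U r (Q x)"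
        by (simp add: Q.add Q.scaleR commutantD(2)[OF T Q] S_comm_N[OF Q] bounded_operatorsD(2)[OF Qop])
    qed
    ultimately show ?thesis by simp
  qed
  \<comment> \<open>\<open>R\<close> is only real linear, so \<open>R (\<i> *\<^sub>C S x)\<close>
    is left unevaluated; it cancels when the cases \<open>1\<close> and \<open>- 1\<close> are
    added.\<close>
  have "R (T x + r *\<^sub>R \<i> *\<^sub>C S x) = T (R x) + r *\<^sub>R \<i> *\<^sub>C S (R x)" if "r * r = 1" for r
    using combination[OF that] comm by blast
  from this[of 1] this[of "- 1"]
  have "R (T x) + R (\<i> *\<^sub>C S x) = T (R x) + \<i> *\<^sub>C S (R x)"
    "R (T x) - R (\<i> *\<^sub>C S x) = T (R x) - \<i> *\<^sub>C S (R x)"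
    by (simp_all add: linear_add[OF R] linear_diff[OF R])
  then have "(R (T x) + R (\<i> *\<^sub>C S x)) + (R (T x) - R (\<i> *\<^sub>C S x))
      = (T (R x) + \<i> *\<^sub>C S (R x)) + (T (R x) - \<i> *\<^sub>C S (R x))"
    by (rule arg_cong2)
  then have "2 *\<^sub>R R (T x) = 2 *\<^sub>R T (R x)" unfolding scaleR_2 by simp
  then show ?thesis by simp
qed

lemma bounded_operators_scaleC:
  assumes "T \<in> bounded_operators"
  shows "T (c *\<^sub>C x) = c *\<^sub>C T x"
  using assms by (auto simp: bounded_operators_def Vector_Spaces.linear_iff)

lemma commutant_linear_combination:
  assumes N: "N \<subseteq> bounded_operators" and S: "S \<in> commutant N" and T: "T \<in> commutant N"
  shows "(\<lambda>x. a *\<^sub>C S x + b *\<^sub>C T x) \<in> commutant N"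
proof (rule commutantI)
  have scale: "bounded_linear (\<lambda>x. c *\<^sub>C U x)" if "bounded_linear U" for U :: "'a \<Rightarrow> 'a" and c
    unfolding scaleC_eq_scaleR[of c]
    by (intro bounded_linear_add bounded_linear_const_scaleR
        bounded_linear_compose[OF bounded_linear_imaginary] that)
  have "bounded_linear (\<lambda>x. a *\<^sub>C S x + b *\<^sub>C T x)"
    by (intro bounded_linear_add scale bounded_operatorsD commutantD(1)[OF S] commutantD(1)[OF T])
  then show "(\<lambda>x. a *\<^sub>C S x + b *\<^sub>C T x) \<in> bounded_operators"
    by (simp add: bounded_operators_iff bounded_operatorsD(2)[OF commutantD(1)[OF S]]
        bounded_operatorsD(2)[OF commutantD(1)[OF T]] scaleC_add_right scaleC_scaleC mult.commute)
  fix Q x assume Q: "Q \<in> N"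
  then have Qop: "Q \<in> bounded_operators" using N by auto
  then show "Q (a *\<^sub>C S x + b *\<^sub>C T x) = a *\<^sub>C S (Q x) + b *\<^sub>C T (Q x)"
    using linear_add[OF bounded_linear.linear[OF bounded_operatorsD(1)[OF Qop]]]
    by (simp add: bounded_operators_scaleC commutantD(2)[OF S Q] commutantD(2)[OF T Q])
qed

text \<open>Consequently, anything commuting with all unitaries of the commutant commutes with the
  imaginary unit, which upgrades real linearity to complex linearity.\<close>

lemma imaginary_unitary_commutant:
  assumes N: "N \<subseteq> bounded_operators"
  shows "unitary (\<lambda>x :: 'h::complex_hilbert. \<i> *\<^sub>C x)" "(\<lambda>x :: 'h. \<i> *\<^sub>C x) \<in> commutant N"
proof -
  have i: "(\<lambda>x :: 'h. \<i> *\<^sub>C x) \<in> bounded_operators"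
    by (simp add: bounded_operators_iff bounded_linear_imaginary)
  show "unitary (\<lambda>x :: 'h. \<i> *\<^sub>C x)"
    by (rule unitaryI[OF i, where V = "\<lambda>x. - (\<i> *\<^sub>C x)"])
      (simp_all add: inner_imaginary_left imaginary_imaginary cvec.scale_minus_right)
  show "(\<lambda>x :: 'h. \<i> *\<^sub>C x) \<in> commutant N"
    using N by (intro commutantI i) (auto simp: bounded_operatorsD(2))
qed

text \<open>\<open>T\<close> is a complex combination of two self-adjoint elements of the commutant,
  and each of these is a positive multiple of a self-adjoint contraction, the case already
  settled.\<close>

lemma commutes_with_commutant:
  fixes N :: "('h::complex_hilbert \<Rightarrow> 'h) set"
  assumes N: "N \<subseteq> bounded_operators" and star: "\<And>S. S \<in> N \<Longrightarrow> cadjoint S \<in> N"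
    and T: "T \<in> commutant N" and R: "linear R"
    and comm: "\<And>U x. U \<in> commutant N \<Longrightarrow> unitary U \<Longrightarrow> R (U x) = U (R x)"
  shows "R (T x) = T (R x)"
proof -
  have selfadjoint_case: "R (H x) = H (R x)"
    if H: "H \<in> commutant N" and sa: "\<And>x y. H x \<bullet> y = x \<bullet> H y" for H x
  proof -
    interpret H: bounded_linear H by (rule bounded_operatorsD[OF commutantD(1)[OF H]])
    obtain K where K: "K > 0" "\<And>x. norm (H x) \<le> norm x * K" using H.pos_bounded by blast
    define H' where "H' x = (1 / K) *\<^sub>R H x" for x
    have "H' = (\<lambda>x. complex_of_real (1 / K) *\<^sub>C H x + 0 *\<^sub>C H x)"
      by (simp add: H'_def fun_eq_iff scaleR_scaleC)
    also have "\<dots> \<in> commutant N" by (rule commutant_linear_combination[OF N H H])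
    finally have "H' \<in> commutant N" .
    moreover have "norm (H' x) \<le> norm x" for x
      using K(1) K(2)[of x] by (simp add: H'_def field_simps)
    moreover have "H' x \<bullet> y = x \<bullet> H' y" for x y by (simp add: H'_def sa)
    ultimately have "R (H' x) = H' (R x)"
      using commutes_with_selfadjoint_contraction[OF N _ _ _ R comm] by blast
    then show ?thesis using K(1) by (simp add: H'_def linear_scale[OF R])
  qed
  let ?T = "cadjoint T"
  note Top = commutantD(1)[OF T]
  have T': "?T \<in> commutant N" by (rule commutant_cadjoint[OF N star T])
  \<comment> \<open>\<open>H\<close> is twice the real part of \<open>T\<close> and \<open>G\<close>
    is minus twice its imaginary part, whence \<open>2 T = H - \<i> G\<close>. The unit coefficients
    fit the shape of \<open>commutant_linear_combination\<close>.\<close>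
  define H where "H x = 1 *\<^sub>C T x + 1 *\<^sub>C ?T x" for x
  define G where "G x = \<i> *\<^sub>C T x + (- \<i>) *\<^sub>C ?T x" for x
  have HG: "H \<in> commutant N" "G \<in> commutant N"
    unfolding H_def G_def by (intro commutant_linear_combination N T T')+
  have "H x \<bullet> y = x \<bullet> H y" for x y
    by (simp add: H_def scaleC_one inner_simps cadjoint_inner[OF Top] cadjoint_inner_left[OF Top])
  moreover have "G x \<bullet> y = x \<bullet> G y" for x y
    by (simp add: G_def cvec.scale_minus_left inner_simps inner_imaginary_left
        cadjoint_inner[OF Top] cadjoint_inner_left[OF Top]
        bounded_operatorsD(2)[OF Top] bounded_operatorsD(2)[OF cadjoint_bounded_operator[OF Top]])
  ultimately have comm_HG: "R (H x) = H (R x)" "R (G x) = G (R x)" for x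
    using selfadjoint_case HG by blast+
  have R_i: "R (\<i> *\<^sub>C x) = \<i> *\<^sub>C R x" for x
    using comm imaginary_unitary_commutant[OF N] by blast
  have T_eq: "2 *\<^sub>R T x = H x - \<i> *\<^sub>C G x" for x
    by (simp add: H_def G_def scaleC_one cvec.scale_right_diff_distrib
        cvec.scale_minus_left scaleR_2 imaginary_imaginary)
  have "2 *\<^sub>R R (T x) = R (H x - \<i> *\<^sub>C G x)" unfolding T_eq[symmetric] by (simp add: linear_scale[OF R])
  also have "\<dots> = 2 *\<^sub>R T (R x)" unfolding T_eq by (simp add: linear_diff[OF R] R_i comm_HG)
  finally show ?thesis by simp
qed

section \<open>Von Neumann algebras and invariant closed subspaces\<close>

lemma von_neumann_algebraD:
  assumes "von_neumann_algebra M"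
  shows "M \<subseteq> bounded_operators" "S \<in> M \<Longrightarrow> cadjoint S \<in> M" "commutant (commutant M) = M"
  using assms by (auto simp: von_neumann_algebra_def unital_star_subalgebra_def)

text \<open>The root commutes with every bounded operator commuting with \<open>A\<close>, in
  particular with the whole commutant, so it lies in the bicommutant.\<close>

lemma von_neumann_algebra_operator_sqrt:
  fixes A :: "'h::complex_hilbert \<Rightarrow> 'h"
  assumes M: "von_neumann_algebra M" and A: "A \<in> M" and "\<And>x y. A x \<bullet> y = x \<bullet> A y"
    and "\<And>x. 0 \<le> A x \<bullet> x" and "\<And>x. A x \<bullet> x \<le> x \<bullet> x"
  shows "\<exists>S\<in>M. (\<forall>x y. S x \<bullet> y = x \<bullet> S y) \<and> (\<forall>x. S (S x) = A x)"
proof -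
  note vN = von_neumann_algebraD[OF M]
  have Aop: "A \<in> bounded_operators" using A vN(1) by auto
  obtain S where S: "bounded_linear S" "\<And>x y. S x \<bullet> y = x \<bullet> S y" "\<And>x. S (S x) = A x"
    and "\<forall>C. bounded_linear C \<longrightarrow> (\<forall>x. C (A x) = A (C x)) \<longrightarrow> (\<forall>x. C (S x) = S (C x))"
    using exists_operator_sqrt[OF bounded_operatorsD(1)[OF Aop] assms(3-5)] by blast
  then have S_comm: "C (S x) = S (C x)" if "bounded_linear C" "\<And>x. C (A x) = A (C x)" for C x
    using that by blast
  have "S (\<i> *\<^sub>C x) = \<i> *\<^sub>C S x" for x
    by (rule S_comm[symmetric]) (simp_all add: bounded_linear_imaginary bounded_operatorsD(2)[OF Aop])
  then have Sop: "S \<in> bounded_operators" by (simp add: bounded_operators_iff S)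
  have "S \<in> commutant (commutant M)"
  proof (rule commutantI[OF Sop])
    fix T x assume T: "T \<in> commutant M"
    show "T (S x) = S (T x)"
      by (rule S_comm) (simp_all add: bounded_operatorsD(1) commutantD(1)[OF T] commutantD(2)[OF T A])
  qed
  then have "S \<in> M" by (simp only: vN(3))
  then show ?thesis using S by blast
qed

text \<open>
  Write the projection onto \<open>G\<close> as a \<open>2 \<times> 2\<close> operator matrix \<open>(E\<^sub>i\<^sub>j)\<close>. Its entries commute with
  the unitaries in the commutant of \<open>M\<close>, hence lie in \<open>M\<close>, and
  \<open>E\<^sub>1\<^sub>1 = E\<^sub>1\<^sub>1 E\<^sub>1\<^sub>1\<^sup>* + E\<^sub>1\<^sub>2 E\<^sub>1\<^sub>2\<^sup>*\<close>, so the square root of \<open>E\<^sub>1\<^sub>1\<close> and the row \<open>(E\<^sub>1\<^sub>1, E\<^sub>1\<^sub>2)\<close> have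
  the same range.
\<close>

lemma exists_range_eq_fst_image:
  fixes M :: "('h::complex_hilbert \<Rightarrow> 'h) set"
  assumes M: "von_neumann_algebra M" and G: "subspace G" "closed G"
    and invariant: "\<And>U x y. U \<in> commutant M \<Longrightarrow> unitary U \<Longrightarrow> (x, y) \<in> G \<Longrightarrow> (U x, U y) \<in> G"
  shows "\<exists>S\<in>M. range S = fst ` G"
proof -
  note vN = von_neumann_algebraD[OF M]
  let ?P = "orth_proj G"
  interpret P: bounded_linear ?P by (rule bounded_linear_orth_proj[OF G])
  define R where "R = (\<lambda>x. fst (?P (x, 0)))"
  have L: "bounded_linear (\<lambda>x :: 'h. ?P (x, 0))"
    by (intro bounded_linear_compose[OF P.bounded_linear_axioms] bounded_linear_Pair
        bounded_linear_ident bounded_linear_zero)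
  have R: "bounded_linear R"
    unfolding R_def by (rule bounded_linear_compose[OF bounded_linear_fst L])
  have R_U: "R (U x) = U (R x)" if U: "U \<in> commutant M" "unitary U" for U x
  proof -
    note Uop = commutantD(1)[OF U(1)]
    interpret U: bounded_linear U by (rule bounded_operatorsD[OF Uop])
    have U': "cadjoint U \<in> commutant M" "unitary (cadjoint U)"
      using commutant_cadjoint[OF vN(1,2) U(1)] unitary_cadjoint[OF U(2)] by auto
    \<comment> \<open>The adjoint of \<open>U\<close> is again a unitary in the commutant, so
      \<open>G\<close> is invariant under \<open>map_prod U U\<close> and under its adjoint.\<close>
    have "?P (map_prod U U (x, 0)) = map_prod U U (?P (x, 0))"
    proof (rule orth_proj_commute[OF G])
      show "linear (map_prod U U)" by (rule linearI) (auto simp: U.add U.scaleR)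
      show "map_prod U U u \<bullet> v = u \<bullet> map_prod (cadjoint U) (cadjoint U) v" for u v
        by (simp add: inner_prod_def cadjoint_inner[OF Uop])
    qed (use invariant U U' in auto)
    then show ?thesis by (simp add: R_def U.zero)
  qed
  have "R (\<i> *\<^sub>C x) = \<i> *\<^sub>C R x" for x
    using R_U imaginary_unitary_commutant[OF vN(1)] by blast
  then have Rop: "R \<in> bounded_operators" using R by (simp add: bounded_operators_iff)
  have "R \<in> commutant (commutant M)"
  proof (rule commutantI[OF Rop])
    show "T (R x) = R (T x)" if "T \<in> commutant M" for T x
      by (rule commutes_with_commutant[OF vN(1,2) that bounded_linear.linear[OF R], symmetric])
        (simp_all add: R_U)
  qed
  then have RM: "R \<in> M" by (simp add: vN(3))
  have inner_R: "R x \<bullet> y = ?P (x, 0) \<bullet> (y, 0)" for x y by (simp add: R_def inner_prod_def)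
  have norm_P: "(norm (?P (x, 0)))\<^sup>2 = R x \<bullet> x" for x
    by (simp add: inner_R power2_norm_eq_inner orth_proj_selfadjoint[OF G] orth_proj_ident[OF G]
        orth_proj_in[OF G])
  have R_selfadjoint: "R x \<bullet> y = x \<bullet> R y" for x y
    unfolding inner_R orth_proj_selfadjoint[OF G] by (simp add: R_def inner_prod_def)
  have R_nonneg: "0 \<le> R x \<bullet> x" for x by (simp flip: norm_P)
  have R_le: "R x \<bullet> x \<le> x \<bullet> x" for x
  proof -
    have "(norm (?P (x, 0)))\<^sup>2 \<le> (norm (x, 0 :: 'h))\<^sup>2"
      by (rule power_mono[OF norm_orth_proj_le[OF G]]) simp
    then show ?thesis unfolding norm_P by (simp add: norm_Pair power2_norm_eq_inner)
  qed
  obtain S where S: "S \<in> M" "\<And>x y. S x \<bullet> y = x \<bullet> S y" "\<And>x. S (S x) = R x"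
    using von_neumann_algebra_operator_sqrt[OF M RM R_selfadjoint R_nonneg R_le] by blast
  \<comment> \<open>\<open>S\<close> is its own adjoint, and \<open>fst (?P k)\<close> is the
    adjoint of \<open>x \<mapsto> ?P (x, 0)\<close>. Both squared norms equal
    \<open>R x \<bullet> x\<close>, so Douglas' comparison applies.\<close>
  have "range S = range (\<lambda>k. fst (?P k))"
  proof (rule range_adjoint_eq)
    show "linear S" using S(1) vN(1) bounded_operatorsD(1) bounded_linear.linear by blast
    show "linear (\<lambda>x. ?P (x, 0))" by (rule bounded_linear.linear[OF L])
    show "S x \<bullet> k = x \<bullet> S k" for x k by (rule S)
    show "?P (x, 0) \<bullet> k = x \<bullet> fst (?P k)" for x k
      unfolding orth_proj_selfadjoint[OF G] by (simp add: inner_prod_def)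
    have "S x \<bullet> S x = ?P (x, 0) \<bullet> ?P (x, 0)" for x
      using norm_P[of x] inner_commute[of x "R x"] by (simp add: S(2,3) power2_norm_eq_inner)
    then show "norm (S x) = norm (?P (x, 0))" for x by (simp only: norm_eq)
  qed
  also have "\<dots> = fst ` range ?P" by (simp add: image_image)
  also have "range ?P = G"
  proof (intro equalityI subsetI)
    show "g \<in> range ?P" if "g \<in> G" for g using orth_proj_ident[OF G that] by (metis rangeI)
  qed (auto simp: orth_proj_in[OF G])
  finally show ?thesis using S(1) by blast
qed

section \<open>Affiliated operators\<close>

text \<open>Conjugation invariance of partial functions includes equality of domains. One inclusion
  of graphs for all \<open>U\<close> suffices, since applying it to \<open>cadjoint U\<close> gives
  the other.\<close>

lemma affiliated_MvN_iff:
  assumes M: "von_neumann_algebra M"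
  shows "T \<in> affiliated_MvN M \<longleftrightarrow> closed_operator T \<and>
    (\<forall>U\<in>commutant M. unitary U \<longrightarrow> (\<forall>x y. T x = Some y \<longrightarrow> T (U x) = Some (U y)))"
proof -
  have "(\<forall>U\<in>commutant M. unitary U \<longrightarrow> (Some \<circ> cadjoint U) \<circ>\<^sub>m T \<circ>\<^sub>m (Some \<circ> U) = T) \<longleftrightarrow>
      (\<forall>U\<in>commutant M. unitary U \<longrightarrow> (\<forall>x y. T x = Some y \<longrightarrow> T (U x) = Some (U y)))"
    (is "?conj \<longleftrightarrow> ?graph")
  proof
    have conj: "((Some \<circ> cadjoint U) \<circ>\<^sub>m T \<circ>\<^sub>m (Some \<circ> U)) x = map_option (cadjoint U) (T (U x))" for U x
      by (simp add: map_comp_def split: option.split)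
    show ?graph if c: ?conj
    proof (intro ballI impI allI)
      fix U x y assume U: "U \<in> commutant M" "unitary U" and y: "T x = Some y"
      have "map_option (cadjoint U) (T (U x)) = Some y"
        using c U y conj[of U x] by simp
      then show "T (U x) = Some (U y)" using unitaryD(3)[OF U(2)] by auto
    qed
    show ?conj if g: ?graph
    proof (intro ballI impI ext)
      fix U x assume U: "U \<in> commutant M" "unitary U"
      have "map_option (cadjoint U) (T (U x)) = T x"
      proof (cases "T x")
        case (Some y)
        then show ?thesis using g U unitaryD(2)[OF U(2)] by simp
      next
        case None
        have "cadjoint U \<in> commutant M" "unitary (cadjoint U)"
          using commutant_cadjoint[OF von_neumann_algebraD(1,2)[OF M] U(1)] unitary_cadjoint[OF U(2)]
          by auto
        then have "T (U x) = Some z \<Longrightarrow> T (cadjoint U (U x)) = Some (cadjoint U z)" for z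
          using g by blast
        then show ?thesis using None unitaryD(2)[OF U(2)] by (cases "T (U x)") auto
      qed
      then show "((Some \<circ> cadjoint U) \<circ>\<^sub>m T \<circ>\<^sub>m (Some \<circ> U)) x = T x" by (simp only: conj)
    qed
  qed
  then show ?thesis by (simp add: affiliated_MvN_def)
qed

lemma subspace_graph:
  assumes "unbounded_operator T"
  shows "subspace (Map.graph T)"
proof (rule subspaceI)
  have dom: "cvec.subspace (dom T)"
    and add: "\<And>x y. x \<in> dom T \<Longrightarrow> y \<in> dom T \<Longrightarrow> the (T (x + y)) = the (T x) + the (T y)"
    and scale: "\<And>c x. x \<in> dom T \<Longrightarrow> the (T (c *\<^sub>C x)) = c *\<^sub>C the (T x)"
    using assms unfolding unbounded_operator_def by blast+
  have graph: "p \<in> Map.graph T \<longleftrightarrow> fst p \<in> dom T \<and> snd p = the (T (fst p))" for p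
    by (cases p) (auto simp: Map.graph_def)
  show "0 \<in> Map.graph T"
    using cvec.subspace_0[OF dom] scale[of 0 0] by (simp add: graph)
  show "p + q \<in> Map.graph T" if "p \<in> Map.graph T" "q \<in> Map.graph T" for p q
    using that cvec.subspace_add[OF dom] add by (simp add: graph)
  show "r *\<^sub>R p \<in> Map.graph T" if "p \<in> Map.graph T" for p r
    using that cvec.subspace_scale[OF dom] scale by (simp add: graph scaleR_scaleC)
qed

lemma affiliated_MvN_dom_ran:
  assumes M: "von_neumann_algebra M" and T: "T \<in> affiliated_MvN M"
  shows "\<exists>S\<in>M. range S = dom T" and "\<exists>S\<in>M. range S = ran T"
proof -
  let ?G = "Map.graph T"
  have closed: "closed ?G" and "unbounded_operator T"
    and inv: "\<And>U x y. U \<in> commutant M \<Longrightarrow> unitary U \<Longrightarrow> (x, y) \<in> ?G \<Longrightarrow> (U x, U y) \<in> ?G"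
    using T unfolding affiliated_MvN_iff[OF M] closed_operator_def by (auto simp: Map.graph_def)
  then have G: "subspace ?G" by (simp add: subspace_graph)
  have "\<exists>S\<in>M. range S = fst ` ?G" by (rule exists_range_eq_fst_image[OF M G closed]) (rule inv)
  then show "\<exists>S\<in>M. range S = dom T" by (simp add: fst_graph_eq_dom)
  \<comment> \<open>The swapped graph need not be the graph of a function; only a closed invariant
    subspace is required.\<close>
  let ?G' = "prod.swap -` ?G"
  have swap: "linear (prod.swap :: 'a \<times> 'a \<Rightarrow> _)" by (rule linearI) auto
  have "\<exists>S\<in>M. range S = fst ` ?G'"
  proof (rule exists_range_eq_fst_image[OF M])
    show "subspace ?G'" by (rule linear_subspace_vimage[OF swap G])
    have "continuous_on UNIV (prod.swap :: 'a \<times> 'a \<Rightarrow> _)"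
      unfolding prod.swap_def by (intro continuous_intros)
    then show "closed ?G'" using closed by (intro closed_vimage)
  qed (use inv in auto)
  moreover have "fst ` ?G' = ran T" by (force simp: Map.graph_def ran_def image_iff)
  ultimately show "\<exists>S\<in>M. range S = ran T" by simp
qed

text \<open>Affiliated operators are built from their graphs, so each converse reduces to closure
  properties of an explicit set of pairs.\<close>

lemma exists_affiliated_MvN_of_graph:
  fixes G :: "('h::complex_hilbert \<times> 'h) set"
  assumes M: "von_neumann_algebra M" and closed: "closed G"
    and zero: "(0, 0) \<in> G"
    and add: "\<And>x y x' y'. (x, y) \<in> G \<Longrightarrow> (x', y') \<in> G \<Longrightarrow> (x + x', y + y') \<in> G"
    and scale: "\<And>c x y. (x, y) \<in> G \<Longrightarrow> (c *\<^sub>C x, c *\<^sub>C y) \<in> G"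
    and unique: "\<And>x y y'. (x, y) \<in> G \<Longrightarrow> (x, y') \<in> G \<Longrightarrow> y = y'"
    and invariant: "\<And>U x y. U \<in> commutant M \<Longrightarrow> unitary U \<Longrightarrow> (x, y) \<in> G \<Longrightarrow> (U x, U y) \<in> G"
  shows "\<exists>T\<in>affiliated_MvN M. dom T = fst ` G \<and> ran T = snd ` G"
proof -
  define T where "T x = (if x \<in> fst ` G then Some (THE y. (x, y) \<in> G) else None)" for x
  have T: "T x = Some y \<longleftrightarrow> (x, y) \<in> G" for x y
  proof -
    have "(THE y. (x, y) \<in> G) = y" if "(x, y) \<in> G" for y
      using that unique by blast
    then show ?thesis by (force simp: T_def)
  qed
  have graph: "Map.graph T = G" by (auto simp: Map.graph_def T)
  have dom: "dom T = fst ` G" "ran T = snd ` G"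
    by (auto simp flip: graph fst_graph_eq_dom snd_graph_ran)
  have "cvec.subspace (dom T)"
    by (rule cvec.subspaceI) (use T zero add scale in \<open>blast+\<close>)
  moreover have "T (x + y) = Some (the (T x) + the (T y))" if "x \<in> dom T" "y \<in> dom T" for x y
    using that T add by fastforce
  moreover have "T (c *\<^sub>C x) = Some (c *\<^sub>C the (T x))" if "x \<in> dom T" for c x
    using that T scale by fastforce
  ultimately have "closed_operator T"
    by (simp add: closed_operator_def unbounded_operator_def graph closed)
  then have "T \<in> affiliated_MvN M" by (simp add: affiliated_MvN_iff[OF M] T invariant)
  then show ?thesis using dom by blast
qed

lemma range_eq_ran_affiliated_MvN:
  assumes M: "von_neumann_algebra M" and A: "A \<in> M"
  shows "\<exists>T\<in>affiliated_MvN M. range A = ran T"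
proof -
  have Aop: "A \<in> bounded_operators" using A von_neumann_algebraD[OF M] by auto
  interpret A: bounded_linear A by (rule bounded_operatorsD[OF Aop])
  let ?G = "{p. snd p = A (fst p)}"
  have "\<exists>T\<in>affiliated_MvN M. dom T = fst ` ?G \<and> ran T = snd ` ?G"
  proof (rule exists_affiliated_MvN_of_graph[OF M])
    show "closed ?G"
      by (intro closed_Collect_eq continuous_intros A.continuous_on)
  qed (auto simp: A.zero A.add bounded_operators_scaleC[OF Aop] commutantD(2)[OF _ A])
  moreover have "snd ` ?G = range A"
  proof -
    have "A x \<in> snd ` ?G" for x by (rule image_eqI[of _ _ "(x, A x)"]) auto
    then show ?thesis by auto
  qed
  ultimately show ?thesis by metis
qed

text \<open>The witness is the inverse of the restriction of \<open>A\<close> to the orthogonal complement of its kernel.\<close>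

lemma range_eq_dom_affiliated_MvN:
  assumes M: "von_neumann_algebra M" and A: "A \<in> M"
  shows "\<exists>T\<in>affiliated_MvN M. range A = dom T"
proof -
  have Aop: "A \<in> bounded_operators" using A von_neumann_algebraD[OF M] by auto
  interpret A: bounded_linear A by (rule bounded_operatorsD[OF Aop])
  define C where "C = {x. \<forall>n. A n = 0 \<longrightarrow> x \<bullet> n = 0}"
  let ?G = "{p. A (snd p) = fst p} \<inter> snd -` C"
  have "\<exists>T\<in>affiliated_MvN M. dom T = fst ` ?G \<and> ran T = snd ` ?G"
  proof (rule exists_affiliated_MvN_of_graph[OF M])
    have "C = (\<Inter>n\<in>{n. A n = 0}. {x. x \<bullet> n = 0})" by (auto simp: C_def)
    also have "closed \<dots>" by (intro closed_INT ballI closed_Collect_eq continuous_intros)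
    finally show "closed ?G"
      by (intro closed_Int closed_Collect_eq closed_vimage continuous_intros A.continuous_on)
    show "(c *\<^sub>C x, c *\<^sub>C y) \<in> ?G" if "(x, y) \<in> ?G" for c x y
    proof -
      \<comment> \<open>\<open>C\<close> is defined by the real inner product; it is a complex
        subspace because the kernel of \<open>A\<close> is stable under the imaginary unit.\<close>
      have "(c *\<^sub>C y) \<bullet> n = 0" if "A n = 0" for n
        using that \<open>(x, y) \<in> ?G\<close>
        by (auto simp: scaleC_eq_scaleR[of c] inner_simps inner_imaginary_left C_def
            bounded_operatorsD(2)[OF Aop])
      then show ?thesis using that by (auto simp: C_def bounded_operators_scaleC[OF Aop])
    qed
    show "y = y'" if "(x, y) \<in> ?G" "(x, y') \<in> ?G" for x y y'
    proof -
      have "A (y - y') = 0" using that by (simp add: A.diff)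
      then have "(y - y') \<bullet> (y - y') = 0"
        unfolding inner_diff_left using that by (simp add: C_def)
      then show ?thesis by simp
    qed
    show "(U x, U y) \<in> ?G" if U: "U \<in> commutant M" "unitary U" and xy: "(x, y) \<in> ?G" for U x y
    proof -
      have Uop: "U \<in> bounded_operators" by (rule commutantD(1)[OF U(1)])
      have U': "cadjoint U \<in> commutant M"
        by (rule commutant_cadjoint[OF von_neumann_algebraD(1,2)[OF M] U(1)])
      interpret U': bounded_linear "cadjoint U"
        by (rule bounded_operatorsD[OF commutantD(1)[OF U']])
      \<comment> \<open>\<open>cadjoint U\<close> commutes with \<open>A\<close> and so preserves
        its kernel; hence \<open>U\<close> preserves the complement.\<close>
      have "U y \<bullet> n = 0" if "A n = 0" for n
        using xy that commutantD(2)[OF U' A, of n] by (simp add: cadjoint_inner[OF Uop] C_def U'.zero)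
      then show ?thesis using xy commutantD(2)[OF U(1) A, of y] by (simp add: C_def)
    qed
  qed (auto simp: C_def A.zero A.add inner_simps)
  moreover have "fst ` ?G = range A"
  proof -
    have "A x \<in> fst ` ?G" for x
    proof -
      have N: "subspace {n. A n = 0}" "closed {n. A n = 0}"
        by (auto intro!: subspaceI closed_Collect_eq continuous_intros A.continuous_on
            simp: A.zero A.add A.scaleR)
      \<comment> \<open>Removing the kernel component moves \<open>x\<close> into \<open>C\<close>
        without changing its image under \<open>A\<close>.\<close>
      let ?x = "x - orth_proj {n. A n = 0} x"
      have "?x \<in> C" using orth_proj_orthogonal[OF N] by (simp add: C_def)
      moreover have "A ?x = A x" using orth_proj_in[OF N, of x] by (simp add: A.diff)
      ultimately show ?thesis by (intro image_eqI[of _ _ "(A x, ?x)"]) auto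
    qed
    then show ?thesis by auto
  qed
  ultimately show ?thesis by metis
qed

text \<open>The domain of a quotient is the range of its denominator, and every \<open>B\<close> in
  \<open>M\<close> is an admissible denominator, for instance with numerator \<open>B\<close>
  itself.\<close>

lemma affiliated_quotients_dom_iff:
  "(\<exists>T\<in>affiliated_quotients M. V = dom T) \<longleftrightarrow> (\<exists>B\<in>M. V = range B)"
proof -
  have dom: "dom (quotient_operator A B) = range B" for A B :: "'a \<Rightarrow> 'a"
    by (auto simp: quotient_operator_def dom_def)
  then show ?thesis unfolding affiliated_quotients_def by blast
qed

theorem theorem5p3:
  fixes M :: "('h::complex_hilbert \<Rightarrow> 'h) set" and V :: "'h set"
  assumes "von_neumann_algebra M" and "cvec.subspace V"
  shows "((\<exists>A\<in>M. V = range A) \<longleftrightarrow> (\<exists>T\<in>affiliated_MvN M. V = ran T)) \<and>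
         ((\<exists>T\<in>affiliated_MvN M. V = ran T) \<longleftrightarrow> (\<exists>T\<in>affiliated_MvN M. V = dom T)) \<and>
         ((\<exists>T\<in>affiliated_MvN M. V = dom T) \<longleftrightarrow> (\<exists>T\<in>affiliated_quotients M. V = dom T))"
proof -
  note M = assms(1)
  have "(\<exists>A\<in>M. V = range A) \<longleftrightarrow> (\<exists>T\<in>affiliated_MvN M. V = ran T)"
    using range_eq_ran_affiliated_MvN[OF M] affiliated_MvN_dom_ran(2)[OF M] by metis
  moreover have "(\<exists>A\<in>M. V = range A) \<longleftrightarrow> (\<exists>T\<in>affiliated_MvN M. V = dom T)"
    using range_eq_dom_affiliated_MvN[OF M] affiliated_MvN_dom_ran(1)[OF M] by metis
  ultimately show ?thesis unfolding affiliated_quotients_dom_iff by simp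
qed

end
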